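(* Let $k\ge 0$ be an integer, let $J=\sum_{\nu\ge 0}\frac{a_\nu(x)}{\nu!}D^\nu$ with polynomials $a_\nu(x)=\sum_{i=0}^{\nu}a_i^{[\nu]}x^i$, and suppose that $J(x^k)=a_0^{[k]}\ne 0$, that $\deg\left(J(x^{n+k})\right)=n$ for all $n\ge 0$, and, if $k\ge 1$, that $J(x^i)=0$ for $0\le i\le k-1$. Let $\{P_n\}_{n\ge 0}$ be a monic polynomial sequence with dual sequence $\{u_n\}_{n\ge 0}$, and let $$\tilde P_n(x)=\left(\lambda_{n+k}^{[k]}\right)^{-1}J(P_{n+k})(x),\quad n\ge 0.$$ Then $\tilde P_n(x)=P_n(x)$ for all $n\ge 0$ if and only if $J(u_n)=\lambda_{n+k}^{[k]}\,u_{n+k}$ for all $n\ge 0$.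
   Context: $\mathcal{P}$ is the vector space of polynomials in $x$ with coefficients in $\mathbb{C}$, $\mathcal{P}'$ its (algebraic) dual, $\langle u,p\rangle$ the action of $u\in\mathcal{P}'$ on $p\in\mathcal{P}$, and $D$ the usual derivative on $\mathcal{P}$. A monic polynomial sequence (MPS) is a sequence $\{P_n\}_{n\ge 0}$ of monic polynomials with $\deg P_n=n$ for all $n\ge 0$. Its dual sequence is the unique sequence $\{u_n\}_{n\ge 0}$ in $\mathcal{P}'$ with $\langle u_n,P_m\rangle=\delta_{n,m}$ for all $n,m\ge 0$. The constants $\lambda_{n+k}^{[k]}$ are $$\lambda_{n+k}^{[k]}:=\sum_{\nu=0}^{n}\binom{n+k}{n+k-\nu}a_{n-\nu}^{[n+k-\nu]},\quad n\ge 0;$$ $\lambda_{n+k}^{[k]}$ is the coefficient of $x^n$ in $J(x^{n+k})$ and is non-zero under the assumptions on $J$, so that $\{\tilde P_n\}_{n\ge0}$ is a MPS. For $u\in\mathcal{P}'$, $J(u)$ denotes the transpose of $J$ applied to $u$: $\langle J(u),p\rangle=\langle u,J(p)\rangle$ for all $p\in\mathcal{P}$. *)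

theory Defs
  imports Complex_Main "HOL-Computational_Algebra.Polynomial"
begin

text \<open>The formal series $\sum_{\nu \ge 0} \frac{a_\nu}{\nu!} D^\nu$ applied to \<open>p\<close>. All terms with
  \<open>\<nu> > degree p\<close> vanish, so the sum is cut off at the degree (see \<open>J_op_eq_sum_atMost\<close>).\<close>

definition J_op :: "(nat \<Rightarrow> complex poly) \<Rightarrow> complex poly \<Rightarrow> complex poly" where
  "J_op a p = (\<Sum>\<nu>\<le>degree p. smult (1 / fact \<nu>) (a \<nu> * (pderiv ^^ \<nu>) p))"

lemma higher_pderiv_eq_0:
  fixes p :: "complex poly"
  assumes "degree p < \<nu>"
  shows "(pderiv ^^ \<nu>) p = 0"
  using assms by (intro poly_eqI) (simp add: coeff_higher_pderiv coeff_eq_0)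

lemma J_op_eq_sum_atMost:
  assumes "degree p \<le> N"
  shows "J_op a p = (\<Sum>\<nu>\<le>N. smult (1 / fact \<nu>) (a \<nu> * (pderiv ^^ \<nu>) p))"
  unfolding J_op_def
  by (rule sum.mono_neutral_left) (use assms in \<open>auto simp: higher_pderiv_eq_0\<close>)

text \<open>\<open>lam a k n\<close> is $\lambda_{n+k}^{[k]}$; the coefficient $a_i^{[\nu]}$ is \<open>coeff (a \<nu>) i\<close>.\<close>

definition lam :: "(nat \<Rightarrow> complex poly) \<Rightarrow> nat \<Rightarrow> nat \<Rightarrow> complex" where
  "lam a k n =
     (\<Sum>\<nu>=0..n. of_nat ((n + k) choose (n + k - \<nu>)) * coeff (a (n + k - \<nu>)) (n - \<nu>))"

definition monic_poly_seq :: "(nat \<Rightarrow> complex poly) \<Rightarrow> bool" where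
  "monic_poly_seq P \<longleftrightarrow> (\<forall>n. lead_coeff (P n) = 1 \<and> degree (P n) = n)"

definition poly_dual :: "(complex poly \<Rightarrow> complex) set" where
  "poly_dual = {u. Vector_Spaces.linear smult (*) u}"

definition dual_seq :: "(nat \<Rightarrow> complex poly) \<Rightarrow> (nat \<Rightarrow> complex poly \<Rightarrow> complex) \<Rightarrow> bool" where
  "dual_seq P u \<longleftrightarrow>
     (\<forall>n. u n \<in> poly_dual) \<and> (\<forall>n m. u n (P m) = (if n = m then 1 else 0))"

definition J_transpose ::
    "(nat \<Rightarrow> complex poly) \<Rightarrow> (complex poly \<Rightarrow> complex) \<Rightarrow> complex poly \<Rightarrow> complex" where
  "J_transpose a u = (\<lambda>p. u (J_op a p))"

definition P_tilde ::
    "(nat \<Rightarrow> complex poly) \<Rightarrow> nat \<Rightarrow> (nat \<Rightarrow> complex poly) \<Rightarrow> nat \<Rightarrow> complex poly" where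
  "P_tilde a k P n = smult (inverse (lam a k n)) (J_op a (P (n + k)))"

end

theory Submission imports Defs begin

text \<open>Since \<open>lam a k n\<close> is the leading coefficient of \<open>J_op a (monom 1 (n + k))\<close>, it is nonzero, so the
  left-hand side says \<open>J_op a (P (n + k)) = smult (lam a k n) (P n)\<close>. Both sides then
  compare the matrices of \<open>J_op a\<close> and of its transpose in the dual families \<open>P\<close> and \<open>u\<close>; the entries
  at \<open>P m\<close> with \<open>m < k\<close> vanish because \<open>J_op a\<close> kills polynomials of degree less than \<open>k\<close>.\<close>

text \<open>Induction on the degree bound: subtracting the multiple of \<open>P (Suc N)\<close> that
  cancels the coefficient of index \<open>Suc N\<close> lowers the bound by one.\<close>

lemma poly_eq_sum_of_degree_seq:
  fixes P :: "nat \<Rightarrow> 'a :: field poly"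
  assumes deg: "\<And>n. degree (P n) = n" and nz: "\<And>n. P n \<noteq> 0"
    and "degree p \<le> N"
  obtains c where "p = (\<Sum>i\<le>N. smult (c i) (P i))"
proof -
  have "\<exists>c. p = (\<Sum>i\<le>N. smult (c i) (P i))"
    using assms(3)
  proof (induction N arbitrary: p)
    case 0
    obtain b where "P 0 = [:b:]" "b \<noteq> 0"
      using deg[of 0] nz[of 0] by (metis degree_eq_zeroE pCons_eq_0_iff)
    moreover obtain d where "p = [:d:]"
      using 0 by (metis degree_eq_zeroE le_zero_eq)
    ultimately have "p = smult (d / b) (P 0)"
      by simp
    then show ?case
      by (auto intro!: exI[of _ "\<lambda>_. d / b"])
  next
    case (Suc N)
    define b where "b = coeff p (Suc N) / lead_coeff (P (Suc N))"
    have "degree (p - smult b (P (Suc N))) \<le> N"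
    proof (rule degree_le, intro allI impI)
      fix i assume "N < i"
      show "coeff (p - smult b (P (Suc N))) i = 0"
      proof (cases "i = Suc N")
        case True
        then show ?thesis
          using nz[of "Suc N"] deg[of "Suc N"] by (simp add: b_def flip: leading_coeff_0_iff)
      next
        case False
        then show ?thesis
          using \<open>N < i\<close> Suc.prems deg[of "Suc N"] by (simp add: coeff_eq_0)
      qed
    qed
    from Suc.IH[OF this] obtain c where
      c: "p - smult b (P (Suc N)) = (\<Sum>i\<le>N. smult (c i) (P i))"
      by blast
    have "p = (\<Sum>i\<le>Suc N. smult ((c(Suc N := b)) i) (P i))"
      using c by (simp add: algebra_simps)
    then show ?case
      by blast
  qed
  then show thesis
    using that by blast
qed

lemma poly_dual_add: "u \<in> poly_dual \<Longrightarrow> u (p + q) = u p + u q"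
  by (simp add: poly_dual_def Vector_Spaces.linear_iff)

lemma poly_dual_smult: "u \<in> poly_dual \<Longrightarrow> u (smult c p) = c * u p"
  by (simp add: poly_dual_def Vector_Spaces.linear_iff)

lemma poly_dual_sum:
  assumes "u \<in> poly_dual"
  shows "u (\<Sum>i\<in>A. f i) = (\<Sum>i\<in>A. u (f i))"
proof -
  \<comment> \<open>Settles the empty sum, and also infinite \<open>A\<close>, where both sums are 0
    by convention.\<close>
  have "u 0 = 0"
    using poly_dual_smult[OF assms, of 0 0] by simp
  then show ?thesis
    by (induction A rule: infinite_finite_induct) (auto simp: poly_dual_add[OF assms])
qed

lemma J_op_add: "J_op a (p + q) = J_op a p + J_op a q"
proof -
  \<comment> \<open>The cut-off in \<open>J_op\<close> depends on its argument, so the three series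
    are first brought to a common length.\<close>
  define N where "N = max (degree p) (degree q)"
  have "degree p \<le> N" "degree q \<le> N" "degree (p + q) \<le> N"
    by (auto simp: N_def degree_add_le)
  then show ?thesis
    by (simp add: J_op_eq_sum_atMost higher_pderiv_add smult_add_right distrib_left sum.distrib)
qed

lemma J_op_smult: "J_op a (smult c p) = smult c (J_op a p)"
proof -
  \<comment> \<open>Only an inequality, since \<open>c\<close> may be 0; \<open>degree p\<close>
    then serves as cut-off for both sides.\<close>
  have "degree (smult c p) \<le> degree p"
    by (rule degree_smult_le)
  then show ?thesis
    by (intro poly_eqI) (simp add: J_op_eq_sum_atMost[of _ "degree p"] higher_pderiv_smult coeff_sum
        sum_distrib_left mult.left_commute)
qed

lemma J_op_sum: "J_op a (\<Sum>i\<in>A. f i) = (\<Sum>i\<in>A. J_op a (f i))"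
proof -
  have "J_op a 0 = 0"
    using J_op_smult[of a 0 0] by simp
  then show ?thesis
    by (induction A rule: infinite_finite_induct) (auto simp: J_op_add)
qed

lemma J_op_eq_0_if_degree_less:
  assumes "\<And>i. i < k \<Longrightarrow> J_op a (monom 1 i) = 0" and "degree p < k"
  shows "J_op a p = 0"
proof -
  have "p = (\<Sum>i\<le>degree p. smult (coeff p i) (monom 1 i))"
    using poly_as_sum_of_monoms[of p] by (simp add: smult_monom)
  then have "J_op a p = (\<Sum>i\<le>degree p. smult (coeff p i) (J_op a (monom 1 i)))"
    by (metis (no_types, lifting) J_op_smult J_op_sum sum.cong)
  also have "\<dots> = 0"
    using assms by (intro sum.neutral) auto
  finally show ?thesis .
qed

lemma higher_pderiv_monom_1:
  assumes "\<nu> \<le> m"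
  shows "smult (1 / fact \<nu>) ((pderiv ^^ \<nu>) (monom 1 m)) =
    monom (of_nat (m choose \<nu>) :: complex) (m - \<nu>)"
proof (rule poly_eqI)
  fix i
  \<comment> \<open>The rising product from \<open>m - \<nu> + 1\<close> to \<open>m\<close> is the
    factor that \<open>coeff_higher_pderiv\<close> yields at index \<open>m - \<nu>\<close>.\<close>
  have "of_nat (m choose \<nu>) = pochhammer (of_nat (Suc (m - \<nu>))) \<nu> / (fact \<nu> :: complex)"
    using assms by (simp add: binomial_gbinomial gbinomial_pochhammer' of_nat_diff add.commute)
  then show "coeff (smult (1 / fact \<nu>) ((pderiv ^^ \<nu>) (monom 1 m))) i =
      coeff (monom (of_nat (m choose \<nu>) :: complex) (m - \<nu>)) i"
    using assms by (auto simp: coeff_higher_pderiv)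
qed

text \<open>The term of order \<open>\<nu>\<close> is a binomial multiple of \<open>a \<nu>\<close>
  times the monomial of exponent \<open>n + k - \<nu>\<close>. For \<open>\<nu> < k\<close> that
  exponent exceeds \<open>n\<close>; otherwise the coefficient of index \<open>\<nu> - k\<close> of
  \<open>a \<nu>\<close> is picked out.\<close>

lemma coeff_J_op_monom: "coeff (J_op a (monom 1 (n + k))) n = lam a k n"
proof -
  have "coeff (J_op a (monom 1 (n + k))) n =
      (\<Sum>\<nu>\<le>n+k. of_nat ((n + k) choose \<nu>) * (if \<nu> < k then 0 else coeff (a \<nu>) (\<nu> - k)))"
  proof -
    have "coeff (smult (1 / fact \<nu>) (a \<nu> * (pderiv ^^ \<nu>) (monom 1 (n + k)))) n =
        of_nat ((n + k) choose \<nu>) * (if \<nu> < k then 0 else coeff (a \<nu>) (\<nu> - k))"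
      if "\<nu> \<le> n + k" for \<nu>
    proof -
      have "smult (1 / fact \<nu>) (a \<nu> * (pderiv ^^ \<nu>) (monom 1 (n + k))) =
          a \<nu> * monom (of_nat ((n + k) choose \<nu>)) (n + k - \<nu>)"
        using higher_pderiv_monom_1[OF that] by (metis mult_smult_right)
      then show ?thesis
        using that by (auto simp: mult.commute[of "a \<nu>"] coeff_monom_mult intro: arg_cong)
    qed
    then show ?thesis
      by (simp add: J_op_def degree_monom_eq coeff_sum)
  qed
  also have "\<dots> = (\<Sum>\<nu>=k..n+k. of_nat ((n + k) choose \<nu>) * coeff (a \<nu>) (\<nu> - k))"
    by (rule sum.mono_neutral_cong_right) auto
  also have "\<dots> = lam a k n"
    unfolding lam_def
    \<comment> \<open>Reversal of the summation order; it is its own inverse and turns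
      \<open>\<nu> - k\<close> into \<open>n - \<nu>\<close>.\<close>
    by (rule sum.reindex_bij_witness[of _ "\<lambda>\<nu>. n + k - \<nu>" "\<lambda>\<nu>. n + k - \<nu>"]) auto
  finally show ?thesis .
qed

lemma monic_poly_seq_degree: "monic_poly_seq P \<Longrightarrow> degree (P n) = n"
  by (simp add: monic_poly_seq_def)

lemma monic_poly_seq_nonzero: "monic_poly_seq P \<Longrightarrow> P n \<noteq> 0"
  unfolding monic_poly_seq_def by (metis leading_coeff_0_iff zero_neq_one)

text \<open>The dual sequence separates polynomials: \<open>u n\<close> reads off the coefficient of
  \<open>P n\<close> in the expansion of \<open>p - q\<close>.\<close>

lemma dual_seq_eqI:
  assumes P: "monic_poly_seq P" and u: "dual_seq P u" and eq: "\<And>n. u n p = u n q"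
  shows "p = q"
proof -
  define N where "N = degree (p - q)"
  have Pn: "degree (P n) = n" "P n \<noteq> 0" for n
    using P by (simp_all add: monic_poly_seq_degree monic_poly_seq_nonzero)
  have lin: "u n \<in> poly_dual" for n
    using u by (simp add: dual_seq_def)
  obtain c where c: "p - q = (\<Sum>i\<le>N. smult (c i) (P i))"
    using poly_eq_sum_of_degree_seq[of P "p - q" N] Pn by (auto simp: N_def)
  have "c n = 0" if "n \<le> N" for n
  proof -
    have "u n (p - q) = 0"
      using eq[of n] poly_dual_add[OF lin, of n "p - q" q] by simp
    moreover have "u n (p - q) = (\<Sum>i\<le>N. c i * u n (P i))"
      by (simp add: c poly_dual_sum[OF lin] poly_dual_smult[OF lin])
    moreover have "\<dots> = (\<Sum>i\<le>N. if n = i then c i else 0)"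
      using u by (intro sum.cong) (auto simp: dual_seq_def)
    ultimately show ?thesis
      using that by simp
  qed
  then have "p - q = 0"
    unfolding c by simp
  then show ?thesis
    by simp
qed

theorem lemma3p5:
  fixes k :: nat
    and a :: "nat \<Rightarrow> complex poly"
    and P :: "nat \<Rightarrow> complex poly"
    and u :: "nat \<Rightarrow> complex poly \<Rightarrow> complex"
  assumes "\<And>\<nu>. degree (a \<nu>) \<le> \<nu>"
    and "J_op a (monom 1 k) = [:coeff (a k) 0:]" and "coeff (a k) 0 \<noteq> 0"
    and "\<And>n. degree (J_op a (monom 1 (n + k))) = n"
    and "k \<ge> 1 \<Longrightarrow> \<forall>i \<le> k - 1. J_op a (monom 1 i) = 0"
    and "monic_poly_seq P"
    and "dual_seq P u"
  shows "(\<forall>n. P_tilde a k P n = P n) \<longleftrightarrow>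
         (\<forall>n. J_transpose a (u n) = (\<lambda>p. lam a k n * u (n + k) p))"
proof -
  have Pn: "degree (P n) = n" "P n \<noteq> 0" for n
    using assms(6) by (simp_all add: monic_poly_seq_degree monic_poly_seq_nonzero)
  have lin: "u n \<in> poly_dual" and uP: "u n (P m) = (if n = m then 1 else 0)" for n m
    using assms(7) by (auto simp: dual_seq_def)
  \<comment> \<open>Degree 0 does not exclude the zero polynomial, so \<open>n = 0\<close> rests on
    the constant term of \<open>a k\<close>; for positive \<open>n\<close> the degree
    suffices.\<close>
  have lam_nz: "lam a k n \<noteq> 0" for n
  proof (cases n)
    case 0
    then show ?thesis
      using assms(2,3) by (simp flip: coeff_J_op_monom)
  next
    case (Suc m)
    then have "J_op a (monom 1 (n + k)) \<noteq> 0"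
      using assms(4)[of n] by auto
    then show ?thesis
      using assms(4)[of n] by (metis coeff_J_op_monom leading_coeff_0_iff)
  qed
  have J0: "J_op a (P m) = 0" if "m < k" for m
    using J_op_eq_0_if_degree_less[of k a "P m"] assms(5) that Pn by simp
  show ?thesis
  proof (intro iffI allI ext)
    fix n p
    assume "\<forall>n. P_tilde a k P n = P n"
    then have JP: "J_op a (P (m + k)) = smult (lam a k m) (P m)" for m
      using lam_nz[of m] by (metis P_tilde_def right_inverse smult_1_left smult_smult)
    \<comment> \<open>For \<open>m < k\<close> both sides vanish, as
      \<open>n + k \<noteq> m\<close>; for \<open>m = j + k\<close> both are
      \<open>lam a k n\<close> if \<open>j = n\<close> and 0 otherwise.\<close>
    have basis: "u n (J_op a (P m)) = lam a k n * u (n + k) (P m)" for m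
    proof (cases "m < k")
      case True
      then show ?thesis
        using J0 poly_dual_smult[OF lin, of n 0 0] by (simp add: uP)
    next
      case False
      then obtain j where "m = j + k"
        by (metis add.commute le_Suc_ex not_less)
      then show ?thesis
        by (simp add: JP poly_dual_smult[OF lin] uP)
    qed
    obtain c N where p: "p = (\<Sum>i\<le>N. smult (c i) (P i))"
      by (rule poly_eq_sum_of_degree_seq[of P p "degree p"]) (simp_all add: Pn)
    show "J_transpose a (u n) p = lam a k n * u (n + k) p"
      unfolding p J_transpose_def
      by (simp add: J_op_sum J_op_smult poly_dual_sum[OF lin] poly_dual_smult[OF lin]
          basis sum_distrib_left mult.left_commute)
  next
    fix m
    assume "\<forall>n. J_transpose a (u n) = (\<lambda>p. lam a k n * u (n + k) p)"
    then have *: "u n (J_op a p) = lam a k n * u (n + k) p" for n p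
      by (metis J_transpose_def)
    show "P_tilde a k P m = P m"
    \<comment> \<open>Tested against \<open>u n\<close>, the left side is
      \<open>lam a k n / lam a k m\<close> times the value of \<open>u (n + k)\<close> at
      \<open>P (m + k)\<close>, which is 1 if \<open>n = m\<close> and 0 otherwise.\<close>
    proof (rule dual_seq_eqI[OF assms(6,7)])
      show "u n (P_tilde a k P m) = u n (P m)" for n
        using lam_nz[of m] by (simp add: P_tilde_def poly_dual_smult[OF lin] * uP)
    qed
  qed
qed

end
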